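(* Let $v$, $k$ and $\lambda$ be positive integers such that $3 \leq k < v$, let $r$ and $d$ be the integers such that $\lambda(v-1)=r(k-1)-d$ and $0 \leq d < k-1$, let $n=r-\lambda$, and suppose that $r<k$. If $d \geq n$, then $$C_{\lambda}(v,k) \geq \left\lceil CB_{(v,k,\lambda)}\!\left(\tfrac{n+1}{2d+2},\tfrac{n+1}{2(d+k)}\right)\right\rceil.$$
   Context: A $(v,k,\lambda)$-covering is a pair $(V,\mathcal{B})$ where $V$ is a set of $v$ points and $\mathcal{B}$ is a collection of $k$-subsets of $V$ (blocks) such that every pair of distinct points lies together in at least $\lambda$ blocks; $C_\lambda(v,k)$ is the minimum number of blocks in a $(v,k,\lambda)$-covering. For positive integers $v,k,\lambda$ with $3\le k<v$ and nonnegative reals $\alpha\ge\beta$, define $$CB_{(v,k,\lambda)}(\alpha,\beta)=\frac{rv(\alpha-\beta)+\alpha v}{k(\alpha-\beta)+1},\qquad r=\left\lceil\frac{\lambda(v-1)}{k-1}\right\rceil.$$ *)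

theory Defs
  imports Complex_Main "HOL-Library.Multiset"
begin

(* Blocks form a multiset: a k-subset may occur several times, and each occurrence counts. *)
definition is_covering :: "nat \<Rightarrow> nat \<Rightarrow> nat \<Rightarrow> 'a set \<Rightarrow> 'a set multiset \<Rightarrow> bool" where
  "is_covering v k lam V B \<longleftrightarrow>
     finite V \<and> card V = v \<and>
     (\<forall>b. b \<in># B \<longrightarrow> b \<subseteq> V \<and> card b = k) \<and>
     (\<forall>x\<in>V. \<forall>y\<in>V. x \<noteq> y \<longrightarrow> lam \<le> size {#b \<in># B. x \<in> b \<and> y \<in> b#})"

(* Points may be taken in nat, since every finite point set can be relabelled.
   A covering exists whenever 2 \<le> k \<le> v (take every k-subset lam times),
   so the minimum is then attained. *)
definition covering_number :: "nat \<Rightarrow> nat \<Rightarrow> nat \<Rightarrow> nat" where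
  "covering_number lam v k =
     (LEAST m. \<exists>(V :: nat set) B. is_covering v k lam V B \<and> size B = m)"

definition covering_r :: "nat \<Rightarrow> nat \<Rightarrow> nat \<Rightarrow> int" where
  "covering_r v k lam = \<lceil>real lam * (real v - 1) / (real k - 1)\<rceil>"

definition CB :: "nat \<Rightarrow> nat \<Rightarrow> nat \<Rightarrow> real \<Rightarrow> real \<Rightarrow> real" where
  "CB v k lam \<alpha> \<beta> =
     (of_int (covering_r v k lam) * real v * (\<alpha> - \<beta>) + \<alpha> * real v) / (real k * (\<alpha> - \<beta>) + 1)"

end

theory Submission
  imports Defs
begin

text \<open>
  A point \<open>x\<close> in \<open>r + i\<close> blocks has degree \<open>d + i * (k - 1)\<close> in the excess multigraph, where
  \<open>x\<close> and \<open>y\<close> are joined by as many edges as there are blocks beyond \<open>lam\<close> containing both.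
  If \<open>S\<close> induces a submultigraph of maximum degree less than \<open>n = r - lam\<close>, then
  the Gram matrix of the rows of \<open>S\<close> in the incidence matrix is \<open>lam * J\<close> plus a strictly diagonally
  dominant matrix, so that these rows are independent and there are at least \<open>card S\<close> blocks.
  Repeatedly deleting a vertex of maximum degree yields (Caro and Tuza) such an \<open>S\<close> with at least
  \<open>\<Sum>x. (n + 1) / (2 * (deg x + 1))\<close> elements. This weight is convex in \<open>i\<close>, hence lies above its
  chord \<open>\<alpha> - i * (\<alpha> - \<beta>)\<close> at all integers \<open>i\<close>; counting incidences gives the sum of the
  \<open>i\<close> as \<open>b * k - r * v\<close>, and solving for the number \<open>b\<close> of blocks gives the bound.
\<close>

section \<open>Linear algebra: a lower bound on the number of blocks from a Gram matrix\<close>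

text \<open>Gaussian elimination, by induction on the number of equations: the last equation is
  either trivial or used to eliminate one pivot unknown from all the others.\<close>

lemma underdetermined_system_nontrivial_solution:
  fixes a :: "nat \<Rightarrow> 'a \<Rightarrow> real"
  assumes "finite S" "b < card S"
  shows "\<exists>c. (\<exists>x\<in>S. c x \<noteq> 0) \<and> (\<forall>j<b. (\<Sum>x\<in>S. a j x * c x) = 0)"
  using assms
proof (induction b arbitrary: S a)
  case 0
  then have "S \<noteq> {}" by auto
  then show ?case by (intro exI[of _ "\<lambda>_. 1"]) auto
next
  case (Suc b)
  show ?case
  proof (cases "\<forall>x\<in>S. a b x = 0")
    case True
    obtain c where "\<exists>x\<in>S. c x \<noteq> 0" "\<forall>j<b. (\<Sum>x\<in>S. a j x * c x) = 0"
      using Suc.IH[of S a] Suc.prems by auto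
    with True show ?thesis by (intro exI[of _ c]) (auto simp: less_Suc_eq)
  next
    case False
    then obtain p where p: "p \<in> S" "a b p \<noteq> 0" by auto
    define S' where "S' = S - {p}"
    have S': "finite S'" "p \<notin> S'" "S = insert p S'" using p Suc.prems by (auto simp: S'_def)
    have "b < card S'" using S' Suc.prems by simp
    from Suc.IH[OF S'(1) this, of "\<lambda>j x. a j x - a j p * a b x / a b p"]
    obtain c where c: "\<exists>x\<in>S'. c x \<noteq> 0"
      and sol: "\<And>j. j < b \<Longrightarrow> (\<Sum>x\<in>S'. (a j x - a j p * a b x / a b p) * c x) = 0" by auto
    \<comment> \<open>Back substitution: \<open>t\<close> is the pivot value that makes equation
      \<open>b\<close> hold.\<close>
    define t where "t = - (\<Sum>x\<in>S'. a b x * c x) / a b p"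
    have sum_upd: "(\<Sum>x\<in>S. a j x * (c(p := t)) x) = a j p * t + (\<Sum>x\<in>S'. a j x * c x)" for j
    proof -
      have "(\<Sum>x\<in>S'. a j x * (c(p := t)) x) = (\<Sum>x\<in>S'. a j x * c x)"
        using S'(2) by (intro sum.cong) auto
      then show ?thesis using S' by simp
    qed
    have "(\<Sum>x\<in>S. a j x * (c(p := t)) x) = 0" if "j < Suc b" for j
    proof (cases "j = b")
      case True
      then show ?thesis unfolding sum_upd using p by (simp add: t_def)
    next
      case False
      then have "j < b" using that by simp
      have "(\<Sum>x\<in>S'. (a j x - a j p * a b x / a b p) * c x)
          = (\<Sum>x\<in>S'. a j x * c x) - a j p / a b p * (\<Sum>x\<in>S'. a b x * c x)"
        by (simp add: sum_distrib_left sum_subtractf left_diff_distrib mult.assoc)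
      with sol[OF \<open>j < b\<close>] show ?thesis unfolding sum_upd by (simp add: t_def)
    qed
    moreover have "\<exists>x\<in>S. (c(p := t)) x \<noteq> 0" using c S' by auto
    ultimately show ?thesis by blast
  qed
qed

text \<open>Since the off-diagonal entries are nonnegative, replacing each product
  \<open>c x * c y\<close> by minus half the sum of the two squares can only lower the form. What is
  left is a combination of the squares whose coefficients are the dominance gaps.\<close>

lemma diagonally_dominant_quadratic_form_pos:
  fixes E :: "'a \<Rightarrow> 'a \<Rightarrow> real"
  assumes fin: "finite S"
    and sym: "\<And>x y. x \<in> S \<Longrightarrow> y \<in> S \<Longrightarrow> E x y = E y x"
    and nonneg: "\<And>x y. x \<in> S \<Longrightarrow> y \<in> S \<Longrightarrow> x \<noteq> y \<Longrightarrow> 0 \<le> E x y"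
    and dom: "\<And>x. x \<in> S \<Longrightarrow> (\<Sum>y\<in>S - {x}. E x y) < E x x"
    and c: "\<exists>x\<in>S. c x \<noteq> 0"
  shows "0 < (\<Sum>x\<in>S. \<Sum>y\<in>S. E x y * (c x * c y))"
proof -
  have "0 < (\<Sum>x\<in>S. (E x x - (\<Sum>y\<in>S - {x}. E x y)) * (c x)\<^sup>2)"
  proof -
    obtain z where "z \<in> S" "c z \<noteq> 0" using c by blast
    then show ?thesis
      using dom by (intro sum_pos2[OF fin, of z]) (auto simp: less_imp_le)
  qed
  also have "\<dots> = (\<Sum>x\<in>S. E x x * (c x)\<^sup>2 - (\<Sum>y\<in>S - {x}. E x y * (c x)\<^sup>2))"
    by (simp add: left_diff_distrib sum_distrib_right)
  also have "\<dots> = (\<Sum>x\<in>S. E x x * (c x)\<^sup>2) - (\<Sum>x\<in>S. \<Sum>y\<in>S - {x}. E x y * (c x)\<^sup>2)"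
    by (simp add: sum_subtractf)
  \<comment> \<open>By symmetry of \<open>E\<close>, each off-diagonal entry may be charged half to
    \<open>x\<close> and half to \<open>y\<close>.\<close>
  also have "(\<Sum>x\<in>S. \<Sum>y\<in>S - {x}. E x y * (c x)\<^sup>2)
      = (\<Sum>x\<in>S. \<Sum>y\<in>S - {x}. E x y * ((c x)\<^sup>2 + (c y)\<^sup>2) / 2)"
  proof -
    have off: "(\<Sum>y\<in>S - {x}. g y) = (\<Sum>y\<in>S. if y = x then 0 else g y)" for x and g :: "'a \<Rightarrow> real"
      using fin by (intro sum.mono_neutral_cong_left) auto
    have "(\<Sum>x\<in>S. \<Sum>y\<in>S - {x}. E x y * (c x)\<^sup>2) = (\<Sum>x\<in>S. \<Sum>y\<in>S - {x}. E x y * (c y)\<^sup>2)"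
      unfolding off by (subst sum.swap) (auto intro!: sum.cong simp: sym)
    then show ?thesis
      by (simp add: distrib_left add_divide_distrib sum.distrib flip: sum_divide_distrib)
  qed
  also have "(\<Sum>x\<in>S. E x x * (c x)\<^sup>2) - (\<Sum>x\<in>S. \<Sum>y\<in>S - {x}. E x y * ((c x)\<^sup>2 + (c y)\<^sup>2) / 2)
      = (\<Sum>x\<in>S. E x x * (c x)\<^sup>2 + (\<Sum>y\<in>S - {x}. E x y * (- ((c x)\<^sup>2 + (c y)\<^sup>2) / 2)))"
    by (simp only: sum.distrib sum_negf diff_conv_add_uminus mult_minus_right
        minus_divide_left[symmetric] times_divide_eq_right)
  also have "\<dots> \<le> (\<Sum>x\<in>S. E x x * (c x)\<^sup>2 + (\<Sum>y\<in>S - {x}. E x y * (c x * c y)))"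
  proof -
    have "- (u\<^sup>2 + w\<^sup>2) / 2 \<le> u * w" for u w :: real
      using zero_le_power2[of "u + w"] by (simp add: power2_sum)
    then show ?thesis
      using nonneg by (intro sum_mono add_left_mono mult_left_mono) auto
  qed
  also have "\<dots> = (\<Sum>x\<in>S. \<Sum>y\<in>S. E x y * (c x * c y))"
    using fin by (intro sum.cong) (auto simp: power2_eq_square sum.remove)
  finally show ?thesis .
qed

text \<open>With fewer than \<open>card S\<close> columns, some nonzero combination \<open>c\<close>
  of the rows vanishes, so the Gram form is zero at \<open>c\<close>. Yet that form is a positive
  definite one plus \<open>l\<close> times a square.\<close>

lemma card_le_if_gram_dominant:
  fixes inc :: "nat \<Rightarrow> 'a \<Rightarrow> real" and l :: real and b :: nat
  defines "G \<equiv> \<lambda>x y. \<Sum>j<b. inc j x * inc j y"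
  assumes fin: "finite S" and l: "0 \<le> l"
    and ge: "\<And>x y. x \<in> S \<Longrightarrow> y \<in> S \<Longrightarrow> x \<noteq> y \<Longrightarrow> l \<le> G x y"
    and dom: "\<And>x. x \<in> S \<Longrightarrow> (\<Sum>y\<in>S - {x}. G x y - l) < G x x - l"
  shows "card S \<le> b"
proof (rule ccontr)
  assume "\<not> card S \<le> b"
  then obtain c where c: "\<exists>x\<in>S. c x \<noteq> 0"
    and sol: "\<And>j. j < b \<Longrightarrow> (\<Sum>x\<in>S. inc j x * c x) = 0"
    using underdetermined_system_nontrivial_solution[OF fin, of b inc] by auto
  have "0 < (\<Sum>x\<in>S. \<Sum>y\<in>S. (G x y - l) * (c x * c y))"
    using ge dom by (intro diagonally_dominant_quadratic_form_pos[OF fin _ _ _ c])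
      (auto simp: G_def mult.commute)
  also have "\<dots> \<le> (\<Sum>x\<in>S. \<Sum>y\<in>S. (G x y - l) * (c x * c y)) + l * (\<Sum>x\<in>S. c x)\<^sup>2"
    using l by simp
  also have "\<dots> = (\<Sum>x\<in>S. \<Sum>y\<in>S. G x y * (c x * c y))"
    unfolding power2_eq_square sum_product
    by (simp add: left_diff_distrib sum_subtractf sum_distrib_left)
  also have "\<dots> = (\<Sum>x\<in>S. \<Sum>y\<in>S. \<Sum>j<b. (inc j x * c x) * (inc j y * c y))"
    by (simp add: G_def sum_distrib_left sum_distrib_right mult_ac)
  also have "\<dots> = (\<Sum>j<b. \<Sum>x\<in>S. \<Sum>y\<in>S. (inc j x * c x) * (inc j y * c y))"
    by (subst (2) sum.swap, subst sum.swap) simp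
  also have "\<dots> = (\<Sum>j<b. (\<Sum>x\<in>S. inc j x * c x)\<^sup>2)"
    by (simp add: power2_eq_square sum_product)
  also have "\<dots> = 0" using sol by simp
  finally show False by simp
qed

section \<open>Large induced submultigraphs of small maximum degree\<close>

text \<open>For positive \<open>m\<close> the two branches meet at \<open>x = m\<close> with value
  1/2. The linear branch is there because degrees may fall below \<open>m\<close> as vertices are
  deleted.\<close>

definition caro_tuza_weight :: "nat \<Rightarrow> nat \<Rightarrow> real" where
  "caro_tuza_weight m x =
     (if x \<le> m then 1 - real x / (2 * real m) else (real m + 1) / (2 * (real x + 1)))"

lemma caro_tuza_weight_ge:
  assumes "0 < m" "m \<le> x"
  shows "caro_tuza_weight m x = (real m + 1) / (2 * (real x + 1))"
  using assms proof (cases "x = m")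
  case True
  then show ?thesis using assms by (simp add: caro_tuza_weight_def divide_simps)
qed (use assms in \<open>simp add: caro_tuza_weight_def\<close>)

text \<open>The left side equals the decrement of the weight from \<open>D - 1\<close> to
  \<open>D\<close>, also when \<open>D = m\<close>. The weight is convex, so earlier decrements are
  at least as large.\<close>

lemma caro_tuza_weight_step:
  assumes m: "0 < m" "m \<le> D" and x: "Suc x \<le> D"
  shows "caro_tuza_weight m D / real D \<le> caro_tuza_weight m x - caro_tuza_weight m (Suc x)"
proof -
  have D: "caro_tuza_weight m D / real D = (real m + 1) / (2 * (real D * (real D + 1)))"
    using m by (simp add: caro_tuza_weight_ge mult_ac)
  show ?thesis
  proof (cases "Suc x \<le> m")
    case True
    have "real m * (real m + 1) \<le> real D * (real D + 1)"
      using m by (intro mult_mono) auto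
    then have "(real m + 1) / (2 * (real D * (real D + 1)))
        \<le> (real m + 1) / (2 * (real m * (real m + 1)))"
      using m by (intro divide_left_mono mult_pos_pos) (auto simp: add_pos_nonneg)
    also have "\<dots> = 1 / (2 * real m)" by (simp add: divide_simps)
    also have "\<dots> = caro_tuza_weight m x - caro_tuza_weight m (Suc x)"
      using True m by (simp add: caro_tuza_weight_def field_simps)
    finally show ?thesis using D by simp
  next
    case False
    have "(real x + 1) * (real x + 2) \<le> real D * (real D + 1)"
      using x by (intro mult_mono) auto
    then have "(real m + 1) / (2 * (real D * (real D + 1)))
        \<le> (real m + 1) / (2 * ((real x + 1) * (real x + 2)))"
      by (intro divide_left_mono mult_pos_pos) (use m in \<open>auto simp: add_pos_nonneg\<close>)
    also have "\<dots> = (real m + 1) / (2 * (real x + 1)) - (real m + 1) / (2 * (real x + 2))"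
      by (simp add: divide_simps) (simp add: algebra_simps)
    also have "\<dots> = caro_tuza_weight m x - caro_tuza_weight m (Suc x)"
      using False m by (simp add: caro_tuza_weight_ge add_ac)
    finally show ?thesis using D by simp
  qed
qed

lemma caro_tuza_weight_drop:
  assumes "0 < m" "m \<le> D" "x + e \<le> D"
  shows "caro_tuza_weight m (x + e) + real e * (caro_tuza_weight m D / real D)
    \<le> caro_tuza_weight m x"
  using assms(3)
proof (induction e)
  case (Suc e)
  have "caro_tuza_weight m D / real D
      \<le> caro_tuza_weight m (x + e) - caro_tuza_weight m (Suc (x + e))"
    using Suc.prems by (intro caro_tuza_weight_step assms) auto
  with Suc show ?case by (simp add: add_divide_distrib distrib_right)
qed simp

text \<open>While the maximum degree is at least \<open>m\<close>, deleting a vertex of maximum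
  degree never lowers the total weight. Once all degrees are below \<open>m\<close>, every weight is
  at most 1, so the total is at most the number of vertices left.\<close>

lemma caro_tuza_multigraph:
  fixes w :: "'a \<Rightarrow> 'a \<Rightarrow> nat"
  assumes "finite V" "0 < m" "\<And>x y. w x y = w y x"
  shows "\<exists>S\<subseteq>V. (\<forall>x\<in>S. (\<Sum>y\<in>S - {x}. w x y) < m) \<and>
    (\<Sum>x\<in>V. caro_tuza_weight m (\<Sum>y\<in>V - {x}. w x y)) \<le> real (card S)"
  using assms(1)
proof (induction V rule: finite_remove_induct)
  case empty
  then show ?case by auto
next
  case (remove V)
  define deg where "deg x = (\<Sum>y\<in>V - {x}. w x y)" for x
  show ?case
  proof (cases "\<forall>x\<in>V. deg x < m")
    case True
    have "(\<Sum>x\<in>V. caro_tuza_weight m (deg x)) \<le> (\<Sum>x\<in>V. 1)"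
      using True by (intro sum_mono) (auto simp: caro_tuza_weight_def)
    with True show ?thesis by (intro exI[of _ V]) (auto simp: deg_def)
  next
    case False
    define D where "D = Max (deg ` V)"
    have "D \<in> deg ` V" unfolding D_def using remove by (intro Max_in) auto
    then obtain u where u: "u \<in> V" "deg u = D" by auto
    have le_D: "deg x \<le> D" if "x \<in> V" for x using that remove by (simp add: D_def)
    have "m \<le> D" using False le_D by force
    obtain S where S: "S \<subseteq> V - {u}" "\<forall>x\<in>S. (\<Sum>y\<in>S - {x}. w x y) < m"
      "(\<Sum>x\<in>V - {u}. caro_tuza_weight m (\<Sum>y\<in>V - {u} - {x}. w x y)) \<le> real (card S)"
      using remove.IH[OF u(1)] by blast
    let ?q = "caro_tuza_weight m D / real D"
    have "(\<Sum>x\<in>V. caro_tuza_weight m (deg x))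
        = caro_tuza_weight m D + (\<Sum>x\<in>V - {u}. caro_tuza_weight m (deg x))"
      using remove u by (simp add: sum.remove)
    \<comment> \<open>The weight of \<open>u\<close> is shared equally among its \<open>D\<close>
      edges; each neighbour gains at least its share when those edges disappear.\<close>
    also have "caro_tuza_weight m D = (\<Sum>x\<in>V - {u}. real (w x u) * ?q)"
    proof -
      have "real D = (\<Sum>x\<in>V - {u}. real (w x u))"
        by (simp add: u(2)[symmetric] deg_def assms(3)[of u])
      then have "(\<Sum>x\<in>V - {u}. real (w x u) * ?q) = real D * ?q"
        by (simp only: sum_distrib_right)
      then show ?thesis using \<open>m \<le> D\<close> assms(2) by simp
    qed
    also have "(\<Sum>x\<in>V - {u}. real (w x u) * ?q) + (\<Sum>x\<in>V - {u}. caro_tuza_weight m (deg x))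
        = (\<Sum>x\<in>V - {u}. caro_tuza_weight m (deg x) + real (w x u) * ?q)"
      by (simp add: sum.distrib)
    also have "\<dots> \<le> (\<Sum>x\<in>V - {u}. caro_tuza_weight m (\<Sum>y\<in>V - {u} - {x}. w x y))"
    proof (intro sum_mono)
      fix x assume x: "x \<in> V - {u}"
      have "deg x = w x u + (\<Sum>y\<in>V - {x} - {u}. w x y)"
        unfolding deg_def using x u remove by (intro sum.remove) auto
      moreover have "V - {x} - {u} = V - {u} - {x}" by blast
      ultimately have "deg x = (\<Sum>y\<in>V - {u} - {x}. w x y) + w x u" by simp
      with caro_tuza_weight_drop[OF assms(2) \<open>m \<le> D\<close>, of "\<Sum>y\<in>V - {u} - {x}. w x y" "w x u"]
      show "caro_tuza_weight m (deg x) + real (w x u) * ?q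
          \<le> caro_tuza_weight m (\<Sum>y\<in>V - {u} - {x}. w x y)"
        using le_D[of x] x by simp
    qed
    also note S(3)
    finally show ?thesis using S by (intro exI[of _ S]) (auto simp: deg_def)
  qed
qed

section \<open>Auxiliary facts on convexity, counting and the existence of coverings\<close>

text \<open>The chord joins the values at 0 and 1 of a convex function. It exceeds the function only
  strictly between these points, where there is no integer.\<close>

lemma inverse_above_chord:
  fixes A K :: real and i :: nat
  assumes "0 < A" "0 < K"
  shows "1 / A - real i * (1 / A - 1 / (A + K)) \<le> 1 / (A + real i * K)"
proof (cases "i = 0")
  case False
  have pos: "0 < A + real i * K" using assms by (simp add: add_pos_nonneg)
  have "A + K \<le> A + real i * K" using False assms by simp
  then have "real i * K / (A * (A + real i * K)) \<le> real i * K / (A * (A + K))"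
    using assms pos by (intro divide_left_mono mult_left_mono mult_pos_pos) auto
  moreover have "1 / A - 1 / (A + real i * K) = real i * K / (A * (A + real i * K))"
    using assms pos by (simp add: divide_simps)
  moreover have "real i * (1 / A - 1 / (A + K)) = real i * K / (A * (A + K))"
    using assms by (simp add: divide_simps)
  ultimately show ?thesis by linarith
qed simp

lemma size_filter_mset_eq_sum:
  "size (filter_mset P (mset xs)) = (\<Sum>j<length xs. of_bool (P (xs ! j)))"
proof -
  have "size (filter_mset P (mset xs)) = length (filter P xs)"
    by (metis mset_filter size_mset)
  also have "\<dots> = card ({..<length xs} \<inter> {j. P (xs ! j)})"
    by (auto simp: length_filter_conv_card intro!: arg_cong[of _ _ card])
  finally show ?thesis by simp
qed

lemma is_covering_exists:
  assumes "2 \<le> k" "k \<le> v"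
  shows "\<exists>(V :: nat set) B. is_covering v k lam V B"
proof -
  define \<K> where "\<K> = {b. b \<subseteq> {..<v} \<and> card b = k}"
  have fin: "finite \<K>" by (simp add: \<K>_def)
  have "lam \<le> size {#b \<in># repeat_mset lam (mset_set \<K>). x \<in> b \<and> y \<in> b#}"
    if xy: "x \<in> {..<v}" "y \<in> {..<v}" "x \<noteq> y" for x y
  proof -
    obtain b where b: "{x, y} \<subseteq> b" "b \<subseteq> {..<v}" "card b = k"
      using exists_subset_between[of "{x, y}" k "{..<v}"] xy assms by auto
    have "lam \<le> count {#b \<in># repeat_mset lam (mset_set \<K>). x \<in> b \<and> y \<in> b#} b"
      using b fin by (simp add: \<K>_def)
    also have "\<dots> \<le> size {#b \<in># repeat_mset lam (mset_set \<K>). x \<in> b \<and> y \<in> b#}"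
      by (rule count_le_size)
    finally show ?thesis .
  qed
  moreover have "finite {..<v}" "card {..<v} = v" by auto
  moreover have "b \<in> \<K>" if "b \<in># repeat_mset lam (mset_set \<K>)" for b
    using that fin by (auto simp: count_mset_set' simp flip: count_greater_zero_iff split: if_splits)
  ultimately have "is_covering v k lam {..<v} (repeat_mset lam (mset_set \<K>))"
    unfolding is_covering_def \<K>_def by blast
  then show ?thesis by blast
qed

text \<open>Existence of a covering is what gives \<open>LEAST\<close> its meaning here.\<close>

lemma covering_number_attained:
  assumes "2 \<le> k" "k \<le> v"
  obtains V :: "nat set" and B where "is_covering v k lam V B" "size B = covering_number lam v k"
proof -
  have "\<exists>m. \<exists>(V :: nat set) B. is_covering v k lam V B \<and> size B = m"
    using is_covering_exists[OF assms] by blast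
  from LeastI_ex[OF this] that show ?thesis by (auto simp: covering_number_def)
qed

section \<open>The bound for an arbitrary covering\<close>

lemma covering_size_ge_CB:
  fixes v k lam :: nat and r d n :: int and V :: "'a set"
  assumes cov: "is_covering v k lam V B"
    and k: "3 \<le> k" and kv: "k < v" and lam: "0 < lam"
    and rd: "int lam * (int v - 1) = r * (int k - 1) - d"
    and d: "0 \<le> d" "d < int k - 1"
    and n: "n = r - int lam" and dn: "n \<le> d"
  shows "CB v k lam ((of_int n + 1) / (2 * of_int d + 2)) ((of_int n + 1) / (2 * (of_int d + real k)))
    \<le> real (size B)"
proof -
  have V: "finite V" "card V = v" using cov by (auto simp: is_covering_def)
  \<comment> \<open>Listing the blocks gives repeated blocks separate columns of the incidence
    matrix.\<close>
  obtain bs where bs: "mset bs = B" using ex_mset by blast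
  define b where "b = length bs"
  have b: "size B = b" using bs by (auto simp: b_def)
  have blk: "bs ! j \<subseteq> V" "card (bs ! j) = k" if "j < b" for j
  proof -
    have "bs ! j \<in># B" using that bs by (auto simp: b_def)
    then show "bs ! j \<subseteq> V" "card (bs ! j) = k" using cov by (auto simp: is_covering_def)
  qed
  \<comment> \<open>The Gram matrix of the incidence rows; \<open>N x x\<close> is the number of
    blocks through \<open>x\<close>.\<close>
  define N :: "'a \<Rightarrow> 'a \<Rightarrow> nat"
    where "N x y = (\<Sum>j<b. of_bool (x \<in> bs ! j) * of_bool (y \<in> bs ! j))" for x y
  have N_sym: "N x y = N y x" for x y by (simp add: N_def mult.commute)
  have N_ge: "lam \<le> N x y" if "x \<in> V" "y \<in> V" "x \<noteq> y" for x y
  proof -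
    have "lam \<le> size {#b \<in># mset bs. x \<in> b \<and> y \<in> b#}"
      using cov that bs by (auto simp: is_covering_def)
    then show ?thesis
      unfolding size_filter_mset_eq_sum by (simp add: N_def b_def of_bool_conj)
  qed
  have block_sum: "(\<Sum>y\<in>V. of_bool (y \<in> bs ! j)) = k" if "j < b" for j
    using blk[OF that] V by (simp add: Int_absorb1)
  have row_sum: "(\<Sum>y\<in>V. N x y) = N x x * k" for x
  proof -
    have "(\<Sum>y\<in>V. N x y) = (\<Sum>j<b. of_bool (x \<in> bs ! j) * (\<Sum>y\<in>V. of_bool (y \<in> bs ! j)))"
      unfolding N_def by (subst sum.swap) (simp add: sum_distrib_left)
    also have "\<dots> = (\<Sum>j<b. of_bool (x \<in> bs ! j) * k)"
      using block_sum by (intro sum.cong) auto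
    also have "\<dots> = N x x * k"
      by (simp add: N_def sum_distrib_right flip: of_bool_conj)
    finally show ?thesis .
  qed
  have incidences: "(\<Sum>x\<in>V. N x x) = b * k"
  proof -
    have "(\<Sum>x\<in>V. N x x) = (\<Sum>j<b. \<Sum>x\<in>V. of_bool (x \<in> bs ! j))"
      unfolding N_def by (subst sum.swap) (simp flip: of_bool_conj)
    also have "\<dots> = b * k" using block_sum by simp
    finally show ?thesis .
  qed

  \<comment> \<open>Edge multiplicities of the excess multigraph. By \<open>N_ge\<close> the
    subtraction is not truncated for distinct points of \<open>V\<close>.\<close>
  define w where "w x y = N x y - lam" for x y
  have deg: "int (\<Sum>y\<in>V - {x}. w x y) = d + (int (N x x) - r) * (int k - 1)"
    if x: "x \<in> V" for x
  proof -
    have "int (\<Sum>y\<in>V - {x}. w x y) = (\<Sum>y\<in>V - {x}. int (N x y) - int lam)"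
      unfolding of_nat_sum using N_ge[OF x] by (intro sum.cong) (auto simp: w_def of_nat_diff)
    also have "\<dots> = int (\<Sum>y\<in>V - {x}. N x y) - int lam * (int v - 1)"
      using V x kv by (simp add: sum_subtractf of_nat_diff)
    also have "int (\<Sum>y\<in>V - {x}. N x y) = int (N x x) * (int k - 1)"
    proof -
      have "(\<Sum>y\<in>V - {x}. N x y) + N x x = N x x * k"
        using row_sum[of x] V x by (simp add: sum.remove)
      from arg_cong[OF this, of int] show ?thesis by (simp add: right_diff_distrib)
    qed
    finally show ?thesis using rd by (simp add: algebra_simps)
  qed
  \<comment> \<open>A point in fewer than \<open>r\<close> blocks would have excess degree at most
    \<open>d - (k - 1)\<close>, which is negative.\<close>
  have r_le: "r \<le> int (N x x)" if "x \<in> V" for x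
  proof (rule ccontr)
    assume "\<not> r \<le> int (N x x)"
    then have "(int (N x x) - r) * (int k - 1) \<le> (- 1) * (int k - 1)"
      using k by (intro mult_right_mono) auto
    then have "int (\<Sum>y\<in>V - {x}. w x y) < 0" using deg[OF that] d by simp
    then show False by (simp only: of_nat_less_0_iff)
  qed
  define ex where "ex x = nat (int (N x x) - r)" for x
  have N_ex: "int (N x x) = r + int (ex x)" if "x \<in> V" for x
    using r_le[OF that] by (simp add: ex_def)

  \<comment> \<open>This makes the degree threshold \<open>n\<close> positive, as the deletion
    argument requires.\<close>
  have "int lam < r"
  proof (rule ccontr)
    assume "\<not> int lam < r"
    then have "r * (int k - 1) \<le> int lam * (int k - 1)"
      using k by (intro mult_right_mono) auto
    also have "\<dots> < int lam * (int v - 1)" using kv lam by simp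
    finally show False using rd d by simp
  qed
  define m where "m = nat n"
  have m: "0 < m" "int m = n" using \<open>int lam < r\<close> n by (auto simp: m_def)
  obtain S where S: "S \<subseteq> V" "\<And>x. x \<in> S \<Longrightarrow> (\<Sum>y\<in>S - {x}. w x y) < m"
    and S_card: "(\<Sum>x\<in>V. caro_tuza_weight m (\<Sum>y\<in>V - {x}. w x y)) \<le> real (card S)"
    using caro_tuza_multigraph[OF V(1) m(1), of w] N_sym by (auto simp: w_def)

  have "card S \<le> b"
  proof (rule card_le_if_gram_dominant[where inc = "\<lambda>j x. of_bool (x \<in> bs ! j)" and l = "real lam"])
    have gram: "(\<Sum>j<b. of_bool (x \<in> bs ! j) * of_bool (y \<in> bs ! j)) = real (N x y)" for x y
      by (simp add: N_def)
    show "finite S" using S V finite_subset by blast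
    show "real lam \<le> (\<Sum>j<b. of_bool (x \<in> bs ! j) * of_bool (y \<in> bs ! j))"
      if "x \<in> S" "y \<in> S" "x \<noteq> y" for x y
      unfolding gram using N_ge that S(1) by auto
    show "(\<Sum>y\<in>S - {x}. (\<Sum>j<b. of_bool (x \<in> bs ! j) * of_bool (y \<in> bs ! j)) - real lam)
        < (\<Sum>j<b. of_bool (x \<in> bs ! j) * of_bool (x \<in> bs ! j)) - real lam"
      if x: "x \<in> S" for x
    proof -
      have "(\<Sum>y\<in>S - {x}. real (N x y) - real lam) = real (\<Sum>y\<in>S - {x}. w x y)"
        unfolding of_nat_sum using N_ge x S(1)
        by (intro sum.cong) (auto simp: w_def subset_iff of_nat_diff)
      also have "\<dots> < real m" using S(2)[OF x] by (simp only: of_nat_less_iff)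
      \<comment> \<open>As \<open>x\<close> lies in at least \<open>r\<close> blocks, its reduced
        diagonal entry is at least \<open>r - lam = n\<close>.\<close>
      also have "real m \<le> real (N x x) - real lam"
        using r_le[of x] x S(1) m n by auto
      finally show ?thesis unfolding gram .
    qed
  qed simp

  \<comment> \<open>The weights of the degrees \<open>d\<close> and \<open>d + k - 1\<close>, which
    belong to points in \<open>r\<close> and \<open>r + 1\<close> blocks.\<close>
  define \<alpha> \<beta> :: real where "\<alpha> = (of_int n + 1) / (2 * of_int d + 2)"
    and "\<beta> = (of_int n + 1) / (2 * (of_int d + real k))"
  have weight: "\<alpha> - real (ex x) * (\<alpha> - \<beta>) \<le> caro_tuza_weight m (\<Sum>y\<in>V - {x}. w x y)"
    if x: "x \<in> V" for x
  proof -
    have deg_x: "int (\<Sum>y\<in>V - {x}. w x y) = d + int (ex x) * (int k - 1)"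
      using deg[OF x] N_ex[OF x] by simp
    moreover have "0 \<le> int (ex x) * (int k - 1)" using k by simp
    \<comment> \<open>The hypothesis \<open>n \<le> d\<close> puts every degree in \<open>V\<close>
      on the hyperbolic branch of the weight.\<close>
    ultimately have ge: "m \<le> (\<Sum>y\<in>V - {x}. w x y)" using m(2) dn by linarith
    have real_deg: "real (\<Sum>y\<in>V - {x}. w x y) = of_int d + real (ex x) * (real k - 1)"
      using arg_cong[OF deg_x, of real_of_int] by simp
    have real_m: "real m = of_int n" using m(2) by (metis of_int_of_nat_eq)
    let ?A = "real_of_int d + 1" and ?K = "real k - 1"
    have "\<alpha> = (of_int n + 1) / 2 * (1 / ?A)" "\<beta> = (of_int n + 1) / 2 * (1 / (?A + ?K))"
      by (auto simp: \<alpha>_def \<beta>_def algebra_simps)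
    then have "\<alpha> - real (ex x) * (\<alpha> - \<beta>)
        = (of_int n + 1) / 2 * (1 / ?A - real (ex x) * (1 / ?A - 1 / (?A + ?K)))"
      by (simp only: right_diff_distrib mult_ac)
    also have "\<dots> \<le> (of_int n + 1) / 2 * (1 / (?A + real (ex x) * ?K))"
      using d(1) k m by (intro mult_left_mono inverse_above_chord) auto
    also have "\<dots> = caro_tuza_weight m (\<Sum>y\<in>V - {x}. w x y)"
      unfolding caro_tuza_weight_ge[OF m(1) ge] real_deg real_m by (simp add: add_ac)
    finally show ?thesis .
  qed
  have ex_sum: "(\<Sum>x\<in>V. real (ex x)) = real b * real k - of_int r * real v"
  proof -
    have "(\<Sum>x\<in>V. real (ex x)) = (\<Sum>x\<in>V. real (N x x) - of_int r)"
      using N_ex by (intro sum.cong) (auto simp: ex_def r_le)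
    also have "\<dots> = real (\<Sum>x\<in>V. N x x) - of_int r * real v"
      using V by (simp add: sum_subtractf)
    finally show ?thesis unfolding incidences by simp
  qed
  have "\<alpha> * real v - (real b * real k - of_int r * real v) * (\<alpha> - \<beta>)
      = (\<Sum>x\<in>V. \<alpha> - real (ex x) * (\<alpha> - \<beta>))"
    using V by (simp add: sum_subtractf flip: sum_distrib_right ex_sum)
  also have "\<dots> \<le> real (card S)"
    using sum_mono[OF weight, of V "\<lambda>x. x"] S_card by linarith
  also have "\<dots> \<le> real b" using \<open>card S \<le> b\<close> by simp
  finally have main: "of_int r * real v * (\<alpha> - \<beta>) + \<alpha> * real v \<le> real b * (real k * (\<alpha> - \<beta>) + 1)"
    by (simp add: algebra_simps)

  have "\<beta> \<le> \<alpha>"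
    unfolding \<alpha>_def \<beta>_def using d(1) k m by (intro divide_left_mono) auto
  then have "0 < real k * (\<alpha> - \<beta>) + 1" by (simp add: add_nonneg_pos)
  moreover have "covering_r v k lam = r"
  proof -
    have "real lam * (real v - 1) = of_int r * (real k - 1) - of_int d"
      using arg_cong[OF rd, of real_of_int] by simp
    then have "real lam * (real v - 1) / (real k - 1) = of_int r - of_int d / (real k - 1)"
      using k by (simp add: diff_divide_distrib)
    moreover have "of_int d < real k - 1" using d(2) by linarith
    then have "0 \<le> of_int d / (real k - 1)" "of_int d / (real k - 1) < 1"
      using d(1) k by auto
    ultimately show ?thesis
      unfolding covering_r_def by (intro ceiling_unique) auto
  qed
  ultimately show ?thesis
    using main unfolding CB_def b \<alpha>_def[symmetric] \<beta>_def[symmetric]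
    by (simp add: pos_divide_le_eq)
qed

theorem theorem5p3:
  fixes v k lam :: nat and r d n :: int
  assumes "v > 0" and "k > 0" and "lam > 0"
    and "3 \<le> k" and "k < v"
    and "int lam * (int v - 1) = r * (int k - 1) - d"
    and "0 \<le> d" and "d < int k - 1"
    and "n = r - int lam"
    and "r < int k"
    and "d \<ge> n"
  shows "int (covering_number lam v k) \<ge>
    \<lceil>CB v k lam ((of_int n + 1) / (2 * of_int d + 2)) ((of_int n + 1) / (2 * (of_int d + real k)))\<rceil>"
proof -
  obtain V :: "nat set" and B
    where "is_covering v k lam V B" and "size B = covering_number lam v k"
    using covering_number_attained[of k v lam] assms by auto
  with covering_size_ge_CB[of v k lam V B r d n] assms show ?thesis
    by (simp add: ceiling_le_iff)
qed

end
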